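(* Let $G$ be a group and let $\varphi:G\to G$ be a central automorphism of $G$. Then the set $[e]_{\varphi}$ is a subgroup of $G$.
   Context: An automorphism $\varphi$ of $G$ is called central if it acts by $\varphi(x)=\overline{\varphi}(x)\,x$ for all $x\in G$, where $\overline{\varphi}:G\to Z(G)$ is a homomorphism of $G$ into its center $Z(G)$ (equivalently, $x^{-1}\varphi(x)\in Z(G)$ for all $x\in G$). For an automorphism $\varphi$ of $G$, $[e]_{\varphi}=\{x^{-1}\varphi(x)\mid x\in G\}$ is the twisted conjugacy class of the unit element $e$. *)

theory Defs
  imports "HOL-Algebra.Group"
begin

definition group_center :: "('a, 'b) monoid_scheme \<Rightarrow> 'a set" where
  "group_center G = {z \<in> carrier G. \<forall>x\<in>carrier G. z \<otimes>\<^bsub>G\<^esub> x = x \<otimes>\<^bsub>G\<^esub> z}"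

(* Membership in iso G G constrains \<phi> on the carrier only, so \<phi> may take
   arbitrary values outside it. *)
definition central_automorphism :: "('a, 'b) monoid_scheme \<Rightarrow> ('a \<Rightarrow> 'a) \<Rightarrow> bool" where
  "central_automorphism G \<phi> \<longleftrightarrow>
     \<phi> \<in> iso G G \<and>
     (\<exists>\<psi> \<in> hom G (G\<lparr>carrier := group_center G\<rparr>).
        \<forall>x\<in>carrier G. \<phi> x = \<psi> x \<otimes>\<^bsub>G\<^esub> x)"

definition twisted_class_one :: "('a, 'b) monoid_scheme \<Rightarrow> ('a \<Rightarrow> 'a) \<Rightarrow> 'a set" where
  "twisted_class_one G \<phi> = {inv\<^bsub>G\<^esub> x \<otimes>\<^bsub>G\<^esub> \<phi> x | x. x \<in> carrier G}"

end

theory Submission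
  imports Defs
begin

text \<open>Write the central automorphism as \<open>\<phi> x = \<psi> x \<otimes> x\<close> with \<open>\<psi>\<close> a homomorphism into the
  centre. Since \<open>\<psi> x\<close> commutes with \<open>x\<close>, the element \<open>x\<inverse> \<phi> x\<close> is just \<open>\<psi> x\<close>. The twisted
  class of the unit is therefore the image of \<open>\<psi>\<close>, and the image of a homomorphism is a subgroup.\<close>

theorem proposition12:
  fixes G :: "('a, 'b) monoid_scheme" and \<phi> :: "'a \<Rightarrow> 'a"
  assumes "group G"
    and "central_automorphism G \<phi>"
  shows "subgroup (twisted_class_one G \<phi>) G"
proof -
  interpret group G by fact
  obtain \<psi> where \<psi>: "\<psi> \<in> hom G (G\<lparr>carrier := group_center G\<rparr>)"
    and \<phi>: "\<And>x. x \<in> carrier G \<Longrightarrow> \<phi> x = \<psi> x \<otimes>\<^bsub>G\<^esub> x"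
    using assms(2) unfolding central_automorphism_def by blast
  have central: "\<psi> x \<in> group_center G" if "x \<in> carrier G" for x
    using \<psi> that by (auto simp: hom_def)
  have "\<psi> \<in> hom G G"
    using \<psi> by (auto simp: hom_def group_center_def)
  then interpret \<psi>: group_hom G G \<psi>
    by unfold_locales
  have "inv\<^bsub>G\<^esub> x \<otimes>\<^bsub>G\<^esub> \<phi> x = \<psi> x" if x: "x \<in> carrier G" for x
  proof -
    have "\<phi> x = x \<otimes>\<^bsub>G\<^esub> \<psi> x"
      using central[OF x] x \<phi>[OF x] by (simp add: group_center_def)
    then show ?thesis
      using x by (simp add: m_assoc[symmetric])
  qed
  then have "twisted_class_one G \<phi> = \<psi> ` carrier G"
    unfolding twisted_class_one_def by force
  then show ?thesis
    using \<psi>.img_is_subgroup by simp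
qed

end
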